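(* Let $m,n\geq 1$. For $1\leq r\leq n$ and $0\leq s\leq m-1$ let $\widetilde{\mathrm{Polyo}}^{(r,s)}_{m,n}$ be the set of $P\in\mathrm{Polyo}_{m,n}$ whose labelled bounce path has exactly $r$ labels equal to $1$ and $s$ labels equal to $\overline{1}$, and let $$\widetilde{\mathsf{Nara}}^{(r,s)}_{m,n}(q,t)=\sum_{P\in\widetilde{\mathrm{Polyo}}^{(r,s)}_{m,n}}t^{\mathsf{bounce}(P)}q^{\mathsf{area}(P)}.$$ Then for $1\leq r\leq n-1$ and $0\leq s\leq m-1$, $$\widetilde{\mathsf{Nara}}^{(r,s)}_{m,n}(q,t)=t^{m+n-1}q^{r+s}\sum_{h=1}^{n-r}\sum_{k=0}^{m-s-1}{s+r-1\brack s}_q{s+h-1\brack h}_q\,\widetilde{\mathsf{Nara}}^{(h,k)}_{m-s,n-r}(q,t),$$ while $$\widetilde{\mathsf{Nara}}^{(n,s)}_{m,n}(q,t)=\begin{cases}(qt)^{m+n-1}{m+n-2\brack m-1}_q & \text{if } s=m-1,\\ 0 & \text{if } s<m-1,\end{cases}$$ and $\widetilde{\mathsf{Nara}}^{(r,0)}_{1,n}(q,t)=0$ for $r<n$.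
   Context: $\mathrm{Polyo}_{m,n}$: pairs of lattice paths (upper and lower) from $(0,0)$ to $(m,n)$ with unit North/East steps meeting only at the endpoints, upper path starting North, lower path starting East. $\mathsf{area}(P)$ is the number of unit squares between the paths. Bounce path: starts at $(0,0)$ with one East step, then goes North until reaching the East endpoint of a horizontal step of the upper path, then East until reaching the North endpoint of a vertical step of the lower path, alternating until $(m,n)$. Steps in the $i$-th maximal vertical run are labelled $i$ ($i=1,2,\dots$); steps in the successive maximal horizontal runs are labelled $\overline{0},\overline{1},\overline{2},\dots$. $\mathsf{bounce}(P)$ is the sum of the labels, ignoring bars. $q$-analogues: $[n]_q=1+q+\cdots+q^{n-1}$ for $n\geq1$, $[0]_q!=1$, $[n]_q!=\prod_{i=1}^n[i]_q$, ${n\brack k}_q=\frac{[n]_q!}{[k]_q![n-k]_q!}$ for $0\leq k\leq n$, and ${n\brack k}_q=0$ if $k>n$. *)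

theory Defs
  imports "HOL-Computational_Algebra.Polynomial"
begin

section \<open>Lattice paths and parallelogram polyominoes\<close>

datatype step = North | East

definition vertex :: "step list \<Rightarrow> nat \<Rightarrow> nat \<times> nat" where
  "vertex w i = (count_list (take i w) East, count_list (take i w) North)"

definition vertices :: "step list \<Rightarrow> (nat \<times> nat) set" where
  "vertices w = vertex w ` {..length w}"

definition lattice_paths :: "nat \<Rightarrow> nat \<Rightarrow> step list set" where
  "lattice_paths m n = {w. count_list w East = m \<and> count_list w North = n}"

text \<open>A polyomino is the pair (upper path, lower path). Since the steps are unit steps between
  lattice points, two such paths meet only at their endpoints iff these are the only lattice
  points they share (for \<open>m, n \<ge> 1\<close>).\<close>

definition Polyo :: "nat \<Rightarrow> nat \<Rightarrow> (step list \<times> step list) set" where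
  "Polyo m n = {(U, L). U \<in> lattice_paths m n \<and> L \<in> lattice_paths m n \<and>
     hd U = North \<and> hd L = East \<and> vertices U \<inter> vertices L = {(0, 0), (m, n)}}"

definition east_starts :: "step list \<Rightarrow> (nat \<times> nat) set" where
  "east_starts w = {vertex w i | i. i < length w \<and> w ! i = East}"

definition east_ends :: "step list \<Rightarrow> (nat \<times> nat) set" where
  "east_ends w = {vertex w (Suc i) | i. i < length w \<and> w ! i = East}"

definition north_ends :: "step list \<Rightarrow> (nat \<times> nat) set" where
  "north_ends w = {vertex w (Suc i) | i. i < length w \<and> w ! i = North}"

text \<open>The pair \<open>(x, y)\<close> stands for the unit square with lower left corner \<open>(x, y)\<close>; it lies between
  the paths iff it is below the horizontal step of the upper path and above the horizontal step
  of the lower path in its column.\<close>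

definition squares_between :: "step list \<times> step list \<Rightarrow> (nat \<times> nat) set" where
  "squares_between = (\<lambda>(U, L). {(x, y). \<exists>a b. (x, a) \<in> east_starts L \<and> (x, b) \<in> east_starts U \<and>
     a \<le> y \<and> y < b})"

definition area :: "step list \<times> step list \<Rightarrow> nat" where
  "area P = card (squares_between P)"

section \<open>The bounce path and its labels\<close>

text \<open>\<open>bounce_from P k d (x, y)\<close> lists the next \<open>k\<close> steps of the bounce path when it
  is at \<open>(x, y)\<close> and about to make a step in direction \<open>d\<close>.\<close>

primrec bounce_from :: "step list \<times> step list \<Rightarrow> nat \<Rightarrow> step \<Rightarrow> nat \<times> nat \<Rightarrow> step list" where
  "bounce_from P 0 d p = []"
| "bounce_from P (Suc k) d p = d # (case d of
     North \<Rightarrow> (let p' = (fst p, Suc (snd p))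
       in bounce_from P k (if p' \<in> east_ends (fst P) then East else North) p')
   | East \<Rightarrow> (let p' = (Suc (fst p), snd p)
       in bounce_from P k (if p' \<in> north_ends (snd P) then North else East) p'))"

text \<open>The bounce path of \<open>P \<in> Polyo m n\<close> stays between the two paths, so it arrives at \<open>(m, n)\<close>
  after exactly \<open>m + n\<close> steps, the common length of the two paths.\<close>

definition bounce_path :: "step list \<times> step list \<Rightarrow> step list" where
  "bounce_path P = East # bounce_from P (length (fst P) - 1) North (1, 0)"

text \<open>\<open>label_steps d i w\<close> labels the steps of \<open>w\<close>, where \<open>d\<close> is the step preceding \<open>w\<close> and \<open>i\<close> is the
  number of vertical runs begun before \<open>w\<close>. A bar is represented by the step being \<open>East\<close>. For a
  path starting with \<open>East\<close>, the horizontal run following the \<open>i\<close>-th vertical run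
  is the one labelled \<open>i\<close> barred.\<close>

primrec label_steps :: "step \<Rightarrow> nat \<Rightarrow> step list \<Rightarrow> (step \<times> nat) list" where
  "label_steps d i [] = []"
| "label_steps d i (s # w) =
     (let j = (if d = East \<and> s = North then Suc i else i) in (s, j) # label_steps s j w)"

definition labelled_bounce_path :: "step list \<times> step list \<Rightarrow> (step \<times> nat) list" where
  "labelled_bounce_path P = label_steps East 0 (bounce_path P)"

definition bounce :: "step list \<times> step list \<Rightarrow> nat" where
  "bounce P = sum_list (map snd (labelled_bounce_path P))"

definition Polyo_rs :: "nat \<Rightarrow> nat \<Rightarrow> nat \<Rightarrow> nat \<Rightarrow> (step list \<times> step list) set" where
  "Polyo_rs m n r s = {P \<in> Polyo m n.
     count_list (labelled_bounce_path P) (North, 1) = r \<and>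
     count_list (labelled_bounce_path P) (East, 1) = s}"

lemma length_lattice_path: "w \<in> lattice_paths m n \<Longrightarrow> length w = m + n"
proof -
  have "length w = count_list w East + count_list w North" for w
  proof (induction w)
    case (Cons a w)
    then show ?case by (cases a) auto
  qed simp
  then show "w \<in> lattice_paths m n \<Longrightarrow> length w = m + n"
    by (simp add: lattice_paths_def)
qed

lemma finite_Polyo: "finite (Polyo m n)"
proof -
  have "lattice_paths m n \<subseteq> {w. set w \<subseteq> {North, East} \<and> length w = m + n}"
    using length_lattice_path step.exhaust by blast
  then have "finite (lattice_paths m n)"
    by (rule finite_subset) (simp add: finite_lists_length_eq)
  then have "finite (lattice_paths m n \<times> lattice_paths m n)" by simp
  then show ?thesis
    by (rule rev_finite_subset) (auto simp: Polyo_def)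
qed

section \<open>Polynomials in \<open>q\<close> and \<open>t\<close>\<close>

text \<open>Polynomials in \<open>q\<close> and \<open>t\<close> with integer coefficients are represented as polynomials in \<open>t\<close>
  over the ring of polynomials in \<open>q\<close>.\<close>

definition qvar :: "int poly poly" where
  "qvar = [:[:0, 1:]:]"

definition tvar :: "int poly poly" where
  "tvar = [:0, 1:]"

definition qint :: "nat \<Rightarrow> int poly poly" where
  "qint n = (\<Sum>i<n. qvar ^ i)"

definition qfact :: "nat \<Rightarrow> int poly poly" where
  "qfact n = (\<Prod>i=1..n. qint i)"

text \<open>The division is exact, see \<open>qbinom_exact\<close> below.\<close>

definition qbinom :: "nat \<Rightarrow> nat \<Rightarrow> int poly poly" where
  "qbinom n k = (if k \<le> n then qfact n div (qfact k * qfact (n - k)) else 0)"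

definition Nara :: "nat \<Rightarrow> nat \<Rightarrow> nat \<Rightarrow> nat \<Rightarrow> int poly poly" where
  "Nara m n r s = (\<Sum>P\<in>Polyo_rs m n r s. tvar ^ bounce P * qvar ^ area P)"

lemma qfact_Suc: "qfact (Suc n) = qint (Suc n) * qfact n"
  by (simp add: qfact_def mult.commute)

lemma qint_add: "qint (a + b) = qint a + qvar ^ a * qint b"
  by (induction b) (simp_all add: qint_def power_add algebra_simps)

lemma qfact_dvd: "k \<le> n \<Longrightarrow> qfact k * qfact (n - k) dvd qfact n"
proof (induction n arbitrary: k)
  case 0
  then show ?case by (simp add: qfact_def)
next
  case (Suc n)
  consider "k = 0" | "k = Suc n" | j where "k = Suc j" "k \<le> n"
    using Suc.prems by (metis le_Suc_eq not0_implies_Suc)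
  then show ?case
  proof cases
    case (3 j)
    have 1: "qfact k * qfact (Suc n - k) dvd qint k * qfact n"
    proof -
      have "qfact j * qfact (n - j) dvd qfact n" using Suc.IH 3 by simp
      then have "qint k * (qfact j * qfact (n - j)) dvd qint k * qfact n" by (rule mult_dvd_mono[OF dvd_refl])
      then show ?thesis using 3 by (simp add: qfact_Suc mult.assoc)
    qed
    have 2: "qfact k * qfact (Suc n - k) dvd qint (Suc n - k) * qfact n"
    proof -
      have "qint (Suc n - k) * (qfact k * qfact (n - k)) dvd qint (Suc n - k) * qfact n"
        using Suc.IH 3 by (intro mult_dvd_mono dvd_refl) simp
      then show ?thesis using 3(2) by (simp add: Suc_diff_le qfact_Suc mult_ac)
    qed
    have "qint (Suc n) = qint k + qvar ^ k * qint (Suc n - k)"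
      using qint_add[of k "Suc n - k"] 3 by simp
    then have "qfact (Suc n) = qint k * qfact n + qvar ^ k * (qint (Suc n - k) * qfact n)"
      by (simp add: qfact_Suc algebra_simps)
    then show ?thesis using 1 2 by (metis dvd_add dvd_mult)
  qed (simp_all add: qfact_def)
qed

lemma qbinom_exact: "k \<le> n \<Longrightarrow> qbinom n k * (qfact k * qfact (n - k)) = qfact n"
  using qfact_dvd[of k n] by (simp add: qbinom_def)

end

theory Submission
  imports Defs
begin

text \<open>
  A pair of paths \<open>(U, L)\<close> is a polyomino iff every proper nonempty prefix of \<open>U\<close> has more
  North steps than the prefix of \<open>L\<close> of the same length. If the bounce path starts with
  \<open>E N\<^sup>r E\<^sup>s N\<^sup>h\<close> and \<open>r < n\<close>, then \<open>U = N\<^sup>r E X E Z\<close> and \<open>L = E W N L\<^sub>1\<close>, where \<open>W\<close> is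
  an arbitrary path in an \<open>s \<times> (r - 1)\<close> box and \<open>X\<close> an arbitrary path in an \<open>(s - 1) \<times> h\<close> box;
  the rest, \<open>(N\<^sup>h E Z, E L\<^sub>1)\<close>, is again a polyomino, whose bounce path is the remainder
  of the original one with all labels lowered by one. The areas of \<open>W\<close> and \<open>X\<close> within their boxes
  contribute the two \<open>q\<close>-binomial coefficients. If \<open>r = n\<close>, then \<open>U = N\<^sup>n E\<^sup>m\<close> and
  \<open>L = E W N\<close> with \<open>W\<close> arbitrary.
\<close>

abbreviation easts :: "step list \<Rightarrow> nat" where
  "easts w \<equiv> count_list w East"

abbreviation norths :: "step list \<Rightarrow> nat" where
  "norths w \<equiv> count_list w North"

section \<open>Counting steps\<close>

lemma count_list_replicate: "count_list (replicate k a) b = (if a = b then k else 0)"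
  by (induction k) auto

text \<open>All decompositions below cut a path at its step number \<open>k + 1\<close> in a
  direction \<open>a\<close>. The uniqueness of this cut, shown next, later yields
  injectivity.\<close>

lemma split_at_count:
  "k < count_list w a \<Longrightarrow> \<exists>u v. w = u @ a # v \<and> count_list u a = k"
proof (induction w arbitrary: k)
  case (Cons b w)
  show ?case
  proof (cases "b = a \<and> k = 0")
    case True
    then have "b # w = [] @ a # w \<and> count_list [] a = k" by simp
    then show ?thesis by blast
  next
    case False
    have "(if b = a then k - 1 else k) < count_list w a"
      using Cons.prems False by (auto split: if_splits)
    from Cons.IH[OF this] obtain u v
      where "w = u @ a # v" "count_list u a = (if b = a then k - 1 else k)" by blast
    then have "b # w = (b # u) @ a # v \<and> count_list (b # u) a = k" using False by auto
    then show ?thesis by blast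
  qed
qed simp

lemma split_at_count_unique:
  assumes "u @ a # v = u' @ a # v'" and "count_list u a = count_list u' a"
  shows "u = u'" and "v = v'"
proof -
  have "u = u' \<and> v = v'" using assms
  proof (induction u arbitrary: u')
    case Nil
    then show ?case by (cases u') auto
  next
    case (Cons b u)
    then show ?case by (cases u') (auto split: if_splits)
  qed
  then show "u = u'" "v = v'" by auto
qed

lemma easts_plus_norths: "easts w + norths w = length w"
proof (induction w)
  case (Cons a w)
  then show ?case by (cases a) auto
qed simp

lemma replicate_if_no_easts: "easts w = 0 \<Longrightarrow> w = replicate (norths w) North"
proof (induction w)
  case (Cons a w)
  then show ?case by (cases a) auto
qed simp

lemma replicate_if_no_norths: "norths w = 0 \<Longrightarrow> w = replicate (easts w) East"
proof (induction w)
  case (Cons a w)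
  then show ?case by (cases a) auto
qed simp

lemma count_list_take_le: "count_list (take i w) a \<le> count_list w a"
  by (metis append_take_drop_id count_list_append le_add1)

lemma take_Suc_count:
  "i < length w \<Longrightarrow> count_list (take (Suc i) w) a = count_list (take i w) a + (if w ! i = a then 1 else 0)"
  by (simp add: take_Suc_conv_app_nth)

lemma easts_plus_norths_take: "i \<le> length w \<Longrightarrow> easts (take i w) + norths (take i w) = i"
  by (simp add: easts_plus_norths)

lemma lattice_pathsD:
  assumes "w \<in> lattice_paths m n"
  shows "easts w = m" and "norths w = n" and "length w = m + n"
  using assms length_lattice_path by (auto simp: lattice_paths_def)

lemma finite_lattice_paths: "finite (lattice_paths m n)"
proof -
  have "lattice_paths m n \<subseteq> {w. set w \<subseteq> {North, East} \<and> length w = m + n}"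
    using length_lattice_path step.exhaust by blast
  then show ?thesis
    by (rule finite_subset) (simp add: finite_lists_length_eq)
qed

section \<open>Polyominoes as dominating pairs of paths\<close>

text \<open>After \<open>i\<close> steps both paths are on the antidiagonal x + y = i, so a common
  vertex is reached by both at the same time. The lead of \<open>U\<close> over \<open>L\<close> in
  North steps is 1 after the first step and changes by at most 1 per step, so it can be lost only by
  passing through 0, that is, at a common vertex.\<close>

lemma Polyo_iff:
  assumes "1 \<le> m" "1 \<le> n"
  shows "(U, L) \<in> Polyo m n \<longleftrightarrow> U \<in> lattice_paths m n \<and> L \<in> lattice_paths m n \<and>
    (\<forall>i. 0 < i \<and> i < m + n \<longrightarrow> norths (take i L) < norths (take i U))"
    (is "?P \<longleftrightarrow> ?U \<and> ?L \<and> ?D")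
proof (intro iffI conjI)
  assume P: ?P
  then show U: ?U and L: ?L by (auto simp: Polyo_def)
  have len: "length U = m + n" "length L = m + n" using U L by (simp_all add: length_lattice_path)
  have hd: "hd U = North" "hd L = East" using P by (auto simp: Polyo_def)
  have "norths (take (Suc i) L) < norths (take (Suc i) U)" if "Suc i < m + n" for i
    using that
  proof (induction i)
    case 0
    have "U \<noteq> []" "L \<noteq> []" using len assms by auto
    then have "take (Suc 0) U = [North]" "take (Suc 0) L = [East]"
      using hd by (auto simp: neq_Nil_conv)
    then show ?case by simp
  next
    case (Suc i)
    \<comment> \<open>One step lowers a positive lead by at most 1.\<close>
    have le: "norths (take (Suc (Suc i)) L) \<le> norths (take (Suc (Suc i)) U)"
      using Suc len by (auto simp: take_Suc_count)
    have "norths (take (Suc (Suc i)) L) \<noteq> norths (take (Suc (Suc i)) U)"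
    proof
      assume eq: "norths (take (Suc (Suc i)) L) = norths (take (Suc (Suc i)) U)"
      have "easts (take (Suc (Suc i)) w) + norths (take (Suc (Suc i)) w) = Suc (Suc i)"
        if "w = U \<or> w = L" for w
        using easts_plus_norths_take[of "Suc (Suc i)" w] that Suc.prems len by auto
      from this[of U] this[of L] have e: "easts (take (Suc (Suc i)) L) = easts (take (Suc (Suc i)) U)"
        "easts (take (Suc (Suc i)) U) + norths (take (Suc (Suc i)) U) = Suc (Suc i)"
        using eq by simp_all
      then have "vertex U (Suc (Suc i)) = vertex L (Suc (Suc i))"
        using eq by (simp add: vertex_def)
      moreover have "Suc (Suc i) \<in> {..length U}" "Suc (Suc i) \<in> {..length L}"
        using Suc.prems len by simp_all
      ultimately have "vertex U (Suc (Suc i)) \<in> vertices U \<inter> vertices L"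
        unfolding vertices_def by (metis IntI imageI)
      then have "vertex U (Suc (Suc i)) \<in> {(0, 0), (m, n)}"
        using P by (auto simp: Polyo_def)
      then show False using e Suc.prems by (auto simp: vertex_def)
    qed
    then show ?case using le by simp
  qed
  then show ?D by (metis gr0_implies_Suc)
next
  assume *: "?U \<and> ?L \<and> ?D"
  then have D: ?D by blast
  have len: "length U = m + n" "length L = m + n" using * by (simp_all add: length_lattice_path)
  have ne: "U \<noteq> []" "L \<noteq> []" using len assms by auto
  then obtain a U0 b L0 where UL: "U = a # U0" "L = b # L0" by (metis neq_Nil_conv)
  have "norths (take 1 L) < norths (take 1 U)" using D assms by force
  then have hd: "hd U = North" "hd L = East"
    using UL by (cases a; cases b; simp)+
  have ends: "vertex w 0 = (0, 0)" "vertex w (m + n) = (m, n)" "length w = m + n"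
    if "w = U \<or> w = L" for w
    using that * len by (auto simp: vertex_def lattice_paths_def)
  have "p = (0, 0) \<or> p = (m, n)" if "p \<in> vertices U \<inter> vertices L" for p
  proof -
    obtain i j where ij: "i \<le> m + n" "j \<le> m + n" "p = vertex U i" "p = vertex L j"
      using \<open>p \<in> vertices U \<inter> vertices L\<close> len by (auto simp: vertices_def)
    have "easts (take i U) + norths (take i U) = i" "easts (take j L) + norths (take j L) = j"
      using easts_plus_norths_take[of i U] easts_plus_norths_take[of j L] ij len by auto
    then have "i = j" "norths (take i U) = norths (take i L)" using ij by (auto simp: vertex_def)
    then have "\<not> (0 < i \<and> i < m + n)" using D by force
    then have "i = 0 \<or> i = m + n" using ij by auto
    then show ?thesis using ij ends by auto
  qed
  moreover have "(0, 0) \<in> vertices w" "(m, n) \<in> vertices w" if "w = U \<or> w = L" for w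
    using ends[OF that] unfolding vertices_def
    by (metis atMost_iff imageI le0, metis atMost_iff imageI order_refl)
  ultimately have "vertices U \<inter> vertices L = {(0, 0), (m, n)}" by blast
  then show ?P using * hd by (simp add: Polyo_def)
qed

section \<open>The area\<close>

text \<open>The area below a path and above its horizontal starting line.\<close>

primrec area_under :: "step list \<Rightarrow> nat" where
  "area_under [] = 0"
| "area_under (d # w) = (case d of North \<Rightarrow> easts w | East \<Rightarrow> 0) + area_under w"

text \<open>\<open>area_under\<close> counts the pairs of a North step and a later East step; the
  pairs with the North step in \<open>u\<close> and the East step in \<open>v\<close> form a full
  rectangle.\<close>

lemma area_under_append:
  "area_under (u @ v) = area_under u + area_under v + norths u * easts v"
proof (induction u)
  case (Cons d u)
  then show ?case by (cases d) auto
qed simp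

lemma area_under_replicate: "area_under (replicate k d) = 0"
  by (induction k) (auto simp: count_list_replicate split: step.split)

text \<open>Every pair of a North and an East step has the counted order in exactly one of
  \<open>w\<close> and \<open>rev w\<close>.\<close>

lemma area_under_rev: "area_under w + area_under (rev w) = easts w * norths w"
proof (induction w)
  case (Cons d w)
  then show ?case by (cases d) (auto simp: area_under_append)
qed simp

section \<open>Column heights and the area between two paths\<close>

text \<open>Translates indices of steps into cuts of the word. \<open>Q\<close> receives both ends
  of the step, so the same lemma serves starting points and end points.\<close>

lemma in_steps_iff:
  "(\<exists>i<length w. w ! i = d \<and> Q (vertex w i) (vertex w (Suc i))) \<longleftrightarrow>
   (\<exists>u v. w = u @ d # v \<and> Q (easts u, norths u) (easts (u @ [d]), norths (u @ [d])))"
proof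
  assume "\<exists>i<length w. w ! i = d \<and> Q (vertex w i) (vertex w (Suc i))"
  then obtain i where i: "i < length w" "w ! i = d" "Q (vertex w i) (vertex w (Suc i))" by blast
  have "w = take i w @ d # drop (Suc i) w" using i id_take_nth_drop by blast
  moreover have "Q (easts (take i w), norths (take i w))
     (easts (take i w @ [d]), norths (take i w @ [d]))"
    using i by (cases d) (simp_all add: vertex_def take_Suc_count)
  ultimately show "\<exists>u v. w = u @ d # v \<and>
    Q (easts u, norths u) (easts (u @ [d]), norths (u @ [d]))" by blast
next
  assume "\<exists>u v. w = u @ d # v \<and> Q (easts u, norths u) (easts (u @ [d]), norths (u @ [d]))"
  then obtain u v where w: "w = u @ d # v"
    and Q: "Q (easts u, norths u) (easts (u @ [d]), norths (u @ [d]))" by blast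
  have "length u < length w \<and> w ! length u = d \<and> Q (vertex w (length u)) (vertex w (Suc (length u)))"
    using Q by (simp add: w vertex_def)
  then show "\<exists>i<length w. w ! i = d \<and> Q (vertex w i) (vertex w (Suc i))" by blast
qed

lemma east_starts_iff:
  "(x, y) \<in> east_starts w \<longleftrightarrow> (\<exists>u v. w = u @ East # v \<and> x = easts u \<and> y = norths u)"
proof -
  have "(x, y) \<in> east_starts w \<longleftrightarrow> (\<exists>i<length w. w ! i = East \<and> vertex w i = (x, y))"
    unfolding east_starts_def mem_Collect_eq by metis
  then show ?thesis
    unfolding in_steps_iff[of w East "\<lambda>p p'. p = (x, y)"] by auto
qed

lemma east_ends_iff:
  "(x, y) \<in> east_ends w \<longleftrightarrow> (\<exists>u v. w = u @ East # v \<and> x = Suc (easts u) \<and> y = norths u)"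
proof -
  have "(x, y) \<in> east_ends w \<longleftrightarrow> (\<exists>i<length w. w ! i = East \<and> vertex w (Suc i) = (x, y))"
    unfolding east_ends_def mem_Collect_eq by metis
  then show ?thesis
    unfolding in_steps_iff[of w East "\<lambda>p p'. p' = (x, y)"] by auto
qed

lemma north_ends_iff:
  "(x, y) \<in> north_ends w \<longleftrightarrow> (\<exists>u v. w = u @ North # v \<and> x = easts u \<and> y = Suc (norths u))"
proof -
  have "(x, y) \<in> north_ends w \<longleftrightarrow> (\<exists>i<length w. w ! i = North \<and> vertex w (Suc i) = (x, y))"
    unfolding north_ends_def mem_Collect_eq by metis
  then show ?thesis
    unfolding in_steps_iff[of w North "\<lambda>p p'. p' = (x, y)"] by auto
qed

text \<open>A path makes exactly one East step in each column. The induction runs from the right,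
  since an appended East step opens a new last column at height \<open>norths w\<close> and leaves
  the other columns alone.\<close>

lemma east_starts_heights:
  "\<exists>f. (\<forall>x y. (x, y) \<in> east_starts w \<longleftrightarrow> x < easts w \<and> y = f x) \<and>
       area_under w = (\<Sum>x<easts w. f x)"
proof (induction w rule: rev_induct)
  case Nil
  then show ?case by (simp add: east_starts_def)
next
  case (snoc d w)
  then obtain f where f: "\<And>x y. (x, y) \<in> east_starts w \<longleftrightarrow> x < easts w \<and> y = f x"
    "area_under w = (\<Sum>x<easts w. f x)" by blast
  have split: "(x, y) \<in> east_starts (w @ [d]) \<longleftrightarrow>
     (x, y) \<in> east_starts w \<or> d = East \<and> x = easts w \<and> y = norths w" for x y
  proof -
    have "(\<exists>v. w @ [d] = u @ East # v) \<longleftrightarrow> (\<exists>v. w = u @ East # v) \<or> d = East \<and> u = w" for u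
    proof
      assume "\<exists>v. w @ [d] = u @ East # v"
      then obtain v where "w @ [d] = u @ East # v" by blast
      then show "(\<exists>v. w = u @ East # v) \<or> d = East \<and> u = w"
        by (cases v rule: rev_cases) auto
    qed auto
    then show ?thesis unfolding east_starts_iff by blast
  qed
  show ?case
  proof (cases d)
    case North
    then show ?thesis using f split by (auto simp: area_under_append intro!: exI[of _ f])
  next
    case East
    have "(\<Sum>x<easts w. (f(easts w := norths w)) x) = (\<Sum>x<easts w. f x)"
      by (rule sum.cong) auto
    then show ?thesis using East f split
      by (auto simp: area_under_append less_Suc_eq intro!: exI[of _ "f(easts w := norths w)"])
  qed
qed

text \<open>The two height functions are subtracted column by column. The additive form keeps
  truncated subtraction out of the later computations.\<close>

lemma area_plus_area_under:
  assumes "1 \<le> m" "1 \<le> n" and P: "(U, L) \<in> Polyo m n"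
  shows "area (U, L) + area_under L = area_under U"
proof -
  note P' = P[unfolded Polyo_iff[OF assms(1,2)]]
  then have UL: "easts U = m" "easts L = m" "length U = m + n" "length L = m + n"
    by (auto simp: lattice_pathsD)
  obtain f where f: "\<And>x y. (x, y) \<in> east_starts U \<longleftrightarrow> x < m \<and> y = f x"
    "area_under U = (\<Sum>x<m. f x)" using east_starts_heights[of U] UL by auto
  obtain g where g: "\<And>x y. (x, y) \<in> east_starts L \<longleftrightarrow> x < m \<and> y = g x"
    "area_under L = (\<Sum>x<m. g x)" using east_starts_heights[of L] UL by auto
  have le: "g x \<le> f x" if x: "x < m" for x
  proof (rule ccontr)
    assume "\<not> g x \<le> f x"
    obtain u v where u: "U = u @ East # v" "x = easts u" "f x = norths u"
      using f(1)[of x "f x"] x by (auto simp: east_starts_iff)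
    obtain u' v' where u': "L = u' @ East # v'" "x = easts u'" "g x = norths u'"
      using g(1)[of x "g x"] x by (auto simp: east_starts_iff)
    \<comment> \<open>\<open>?i\<close> is the time just after the East step of \<open>U\<close> in
      column \<open>x\<close>. If \<open>L\<close> crossed this column at a greater height, it would
      not yet have made its East step there, so it would have at most \<open>x\<close> East steps
      and hence more North steps than \<open>U\<close>.\<close>
    let ?i = "Suc (length u)"
    have i: "?i \<le> length u'"
      using \<open>\<not> g x \<le> f x\<close> u u' easts_plus_norths[of u] easts_plus_norths[of u'] by simp
    then have "?i < m + n" using u' UL by simp
    then have "norths (take ?i L) < norths (take ?i U)" using P' by blast
    moreover have "norths (take ?i U) = norths u" by (simp add: u)
    moreover have "easts (take ?i L) \<le> easts u"
      using i count_list_take_le[of ?i u' East] u u' by simp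
    moreover have "easts (take ?i L) + norths (take ?i L) = ?i"
      using i u' easts_plus_norths_take[of ?i L] by simp
    ultimately show False using easts_plus_norths[of u] by simp
  qed
  have "squares_between (U, L) = (SIGMA x:{..<m}. {g x..<f x})"
    by (auto simp: squares_between_def f(1) g(1))
  then have "area (U, L) = (\<Sum>x<m. f x - g x)" by (simp add: area_def)
  also have "\<dots> = (\<Sum>x<m. f x) - (\<Sum>x<m. g x)"
    using le by (subst sum_subtractf_nat) auto
  finally show ?thesis using f(2) g(2) le sum_mono[of "{..<m}" g f] by simp
qed

section \<open>Gaussian binomials as generating functions of the area in a box\<close>

text \<open>Removing the first step gives the q-Pascal recursion: a leading North step adds a row of
  \<open>a\<close> cells, a leading East step adds nothing. Denominators are cleared, so the
  induction is about products of q-factorials.\<close>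

lemma sum_area_under: "(\<Sum>w\<in>lattice_paths a b. qvar ^ area_under w) = qbinom (a + b) a"
proof -
  let ?G = "\<lambda>a b. \<Sum>w\<in>lattice_paths a b. qvar ^ area_under w"
  \<comment> \<open>Every positive q-integer has constant coefficient 1, so q-factorials can be
    cancelled at the end.\<close>
  have nz: "qfact k \<noteq> 0" for k
  proof -
    have "qint (Suc i) \<noteq> 0" for i
    proof
      assume "qint (Suc i) = 0"
      then have "coeff (coeff (qint (Suc i)) 0) 0 = 0" by simp
      moreover have "coeff (coeff (qint (Suc i)) 0) 0 = 1"
        by (induction i) (simp_all add: qint_def qvar_def)
      ultimately show False by simp
    qed
    then show ?thesis by (induction k) (simp_all add: qfact_Suc, simp add: qfact_def)
  qed
  have "?G a b * (qfact a * qfact b) = qfact (a + b)"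
  proof (induction "a + b" arbitrary: a b)
    case 0
    then have "lattice_paths a b = {[]}"
      using length_lattice_path by (fastforce simp: lattice_paths_def)
    then show ?case using 0 by (simp add: qfact_def)
  next
    case (Suc k)
    consider "a = 0" | "b = 0" | a' b' where "a = Suc a'" "b = Suc b'"
      by (metis not0_implies_Suc)
    then show ?case
    proof cases
      case 1
      then have "lattice_paths a b = {replicate b North}"
        using replicate_if_no_easts by (auto simp: lattice_paths_def count_list_replicate)
      then show ?thesis using 1 by (simp add: area_under_replicate qfact_def)
    next
      case 2
      then have "lattice_paths a b = {replicate a East}"
        using replicate_if_no_norths by (auto simp: lattice_paths_def count_list_replicate)
      then show ?thesis using 2 by (simp add: area_under_replicate qfact_def)
    next
      case (3 a' b')
      have "lattice_paths a b = Cons North ` lattice_paths a b' \<union> Cons East ` lattice_paths a' b"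
      proof (intro set_eqI)
        fix w
        show "w \<in> lattice_paths a b \<longleftrightarrow>
          w \<in> Cons North ` lattice_paths a b' \<union> Cons East ` lattice_paths a' b"
          using 3 by (cases w; cases "hd w") (auto simp: lattice_paths_def)
      qed
      then have "?G a b = (\<Sum>w\<in>Cons North ` lattice_paths a b'. qvar ^ area_under w)
          + (\<Sum>w\<in>Cons East ` lattice_paths a' b. qvar ^ area_under w)"
        by (simp add: finite_lattice_paths, subst sum.union_disjoint)
          (auto simp: finite_lattice_paths)
      also have "\<dots> = (\<Sum>w\<in>lattice_paths a b'. qvar ^ a * qvar ^ area_under w) + ?G a' b"
        by (simp add: sum.reindex power_add lattice_pathsD(1) cong: sum.cong)
      also have "\<dots> = qvar ^ a * ?G a b' + ?G a' b" by (simp add: sum_distrib_left)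
      \<comment> \<open>\<open>qint b\<close> is taken out of \<open>qfact b\<close> in the first
        summand and \<open>qint a\<close> out of \<open>qfact a\<close> in the second, which brings
        both into the form of the induction hypothesis.\<close>
      finally have "?G a b * (qfact a * qfact b) =
          qvar ^ a * qint b * (?G a b' * (qfact a * qfact b'))
          + qint a * (?G a' b * (qfact a' * qfact b))"
        by (simp only: 3 qfact_Suc) (simp add: algebra_simps)
      also have "?G a b' * (qfact a * qfact b') = qfact k"
        using Suc(1)[of a b'] Suc(2) 3 by simp
      also have "?G a' b * (qfact a' * qfact b) = qfact k"
        using Suc(1)[of a' b] Suc(2) 3 by simp
      also have "qvar ^ a * qint b * qfact k + qint a * qfact k = qint (a + b) * qfact k"
        by (simp add: qint_add algebra_simps)
      also have "\<dots> = qfact (a + b)" using Suc(2) by (metis qfact_Suc)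
      finally show ?thesis .
    qed
  qed
  also have "\<dots> = qbinom (a + b) a * (qfact a * qfact b)"
    using qbinom_exact[of a "a + b"] by simp
  finally show ?thesis using nz by simp
qed

lemma sum_area_under_rev:
  "(\<Sum>w\<in>lattice_paths a b. qvar ^ area_under (rev w)) = qbinom (a + b) a"
proof -
  have "bij_betw rev (lattice_paths a b) (lattice_paths a b)"
    by (rule bij_betw_byWitness[of _ rev]) (auto simp: lattice_paths_def)
  from sum.reindex_bij_betw[OF this, of "\<lambda>w. qvar ^ area_under w"]
  show ?thesis by (simp add: sum_area_under)
qed

section \<open>The bounce path\<close>

text \<open>By uniqueness of the cut, the column determines the East step and so its height.\<close>

lemma east_ends_split: "(Suc (easts u), y) \<in> east_ends (u @ East # v) \<longleftrightarrow> y = norths u"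
  using split_at_count_unique[of u East v] unfolding east_ends_iff by (metis Suc_inject)

lemma north_ends_split: "(x, Suc (norths u)) \<in> north_ends (u @ North # v) \<longleftrightarrow> x = easts u"
  using split_at_count_unique[of u North v] unfolding north_ends_iff by (metis Suc_inject)

text \<open>A cut inside \<open>u\<close> would have fewer steps \<open>d\<close> before it than
  \<open>u\<close> contains, so the cut falls into \<open>v\<close>.\<close>

lemma append_eq_split_right:
  assumes "u @ v = u1 @ d # u2" and "count_list u d \<le> count_list u1 d"
  obtains v1 where "u1 = u @ v1" "v = v1 @ d # u2"
  using assms by (auto simp: append_eq_append_conv2 append_eq_Cons_conv)

text \<open>The form \<open>Suc x\<close> excludes the East steps of \<open>u\<close>, whose ends
  have first coordinate at most \<open>easts u\<close>; what remains is \<open>v\<close>, translated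
  by the end point of \<open>u\<close>.\<close>

lemma east_ends_append:
  "(easts u + Suc x, y) \<in> east_ends (u @ v) \<longleftrightarrow>
   (\<exists>y'. y = norths u + y' \<and> (Suc x, y') \<in> east_ends v)"
proof
  assume "(easts u + Suc x, y) \<in> east_ends (u @ v)"
  then obtain u1 u2 where 1: "u @ v = u1 @ East # u2" "easts u + x = easts u1" "y = norths u1"
    by (auto simp: east_ends_iff)
  then obtain v1 where "u1 = u @ v1" "v = v1 @ East # u2"
    using append_eq_split_right[of u v u1 East u2] by auto
  then show "\<exists>y'. y = norths u + y' \<and> (Suc x, y') \<in> east_ends v"
    using 1 by (auto simp: east_ends_iff)
next
  assume "\<exists>y'. y = norths u + y' \<and> (Suc x, y') \<in> east_ends v"
  then obtain v1 v2 where "v = v1 @ East # v2" "x = easts v1" "y = norths u + norths v1"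
    by (auto simp: east_ends_iff)
  then have "u @ v = (u @ v1) @ East # v2 \<and> easts u + Suc x = Suc (easts (u @ v1)) \<and>
    y = norths (u @ v1)" by simp
  then show "(easts u + Suc x, y) \<in> east_ends (u @ v)" unfolding east_ends_iff by blast
qed

lemma north_ends_append:
  "(x, norths u + Suc y) \<in> north_ends (u @ v) \<longleftrightarrow>
   (\<exists>x'. x = easts u + x' \<and> (x', Suc y) \<in> north_ends v)"
proof
  assume "(x, norths u + Suc y) \<in> north_ends (u @ v)"
  then obtain u1 u2 where 1: "u @ v = u1 @ North # u2" "norths u + y = norths u1" "x = easts u1"
    by (auto simp: north_ends_iff)
  then obtain v1 where "u1 = u @ v1" "v = v1 @ North # u2"
    using append_eq_split_right[of u v u1 North u2] by auto
  then show "\<exists>x'. x = easts u + x' \<and> (x', Suc y) \<in> north_ends v"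
    using 1 by (auto simp: north_ends_iff)
next
  assume "\<exists>x'. x = easts u + x' \<and> (x', Suc y) \<in> north_ends v"
  then obtain v1 v2 where "v = v1 @ North # v2" "y = norths v1" "x = easts u + easts v1"
    by (auto simp: north_ends_iff)
  then have "u @ v = (u @ v1) @ North # v2 \<and> norths u + Suc y = Suc (norths (u @ v1)) \<and>
    x = easts (u @ v1)" by simp
  then show "(x, norths u + Suc y) \<in> north_ends (u @ v)" unfolding north_ends_iff by blast
qed

section \<open>Runs and translations of bounce paths\<close>

text \<open>The path turns at the first vertex ahead that ends an East step of the upper path; the
  hypothesis places this vertex \<open>j\<close> steps ahead.\<close>

lemma bounce_from_North_run:
  assumes "0 < j" and "\<And>i. 0 < i \<Longrightarrow> i \<le> j \<Longrightarrow> (x, y + i) \<in> east_ends (fst P) \<longleftrightarrow> i = j"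
  shows "bounce_from P (j + k) North (x, y) =
    replicate j North @ bounce_from P k East (x, y + j)"
  using assms
proof (induction j arbitrary: y)
  case (Suc j)
  have 1: "(x, Suc y) \<in> east_ends (fst P) \<longleftrightarrow> j = 0"
    using Suc.prems(2)[of 1] by auto
  show ?case
  proof (cases "j = 0")
    case False
    then have "bounce_from P (j + k) North (x, Suc y) =
      replicate j North @ bounce_from P k East (x, Suc y + j)"
      using Suc.prems(2)[of "Suc _"] by (intro Suc.IH) auto
    then show ?thesis using 1 False by simp
  qed (use 1 in simp)
qed simp

lemma bounce_from_East_run:
  assumes "0 < j" and "\<And>i. 0 < i \<Longrightarrow> i \<le> j \<Longrightarrow> (x + i, y) \<in> north_ends (snd P) \<longleftrightarrow> i = j"
  shows "bounce_from P (j + k) East (x, y) =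
    replicate j East @ bounce_from P k North (x + j, y)"
  using assms
proof (induction j arbitrary: x)
  case (Suc j)
  have 1: "(Suc x, y) \<in> north_ends (snd P) \<longleftrightarrow> j = 0"
    using Suc.prems(2)[of 1] by auto
  show ?case
  proof (cases "j = 0")
    case False
    then have "bounce_from P (j + k) East (Suc x, y) =
      replicate j East @ bounce_from P k North (Suc x + j, y)"
      using Suc.prems(2)[of "Suc _"] by (intro Suc.IH) auto
    then show ?thesis using 1 False by simp
  qed (use 1 in simp)
qed simp

text \<open>A bounce path tests only the vertices that it enters. The positivity conditions ensure
  that every tested point has both coordinates positive, which is the region where the two
  polyominoes are compared.\<close>

lemma bounce_from_translate:
  assumes "\<And>x y. 0 < x \<Longrightarrow> 0 < y \<Longrightarrow>
      (s + x, r + y) \<in> east_ends (fst P) \<longleftrightarrow> (x, y) \<in> east_ends (fst P')"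
    and "\<And>x y. 0 < x \<Longrightarrow> 0 < y \<Longrightarrow>
      (s + x, r + y) \<in> north_ends (snd P) \<longleftrightarrow> (x, y) \<in> north_ends (snd P')"
    and "0 < x" and "d = East \<Longrightarrow> 0 < y"
  shows "bounce_from P k d (s + x, r + y) = bounce_from P' k d (x, y)"
  using assms(3,4)
proof (induction k arbitrary: d x y)
  case (Suc k)
  show ?case
  proof (cases d)
    case North
    show ?thesis
      using Suc.IH[of x _ "Suc y"] Suc.prems assms(1)[of x "Suc y"] North by simp
  next
    case East
    show ?thesis
      using Suc.IH[of "Suc x" _ y] Suc.prems assms(2)[of "Suc x" y] East by simp
  qed
qed simp

lemma length_bounce_from: "length (bounce_from P k d p) = k"
  by (induction k arbitrary: d p) (auto simp: Let_def split: step.split)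

section \<open>Labels of the first runs\<close>

lemma label_steps_replicate:
  "label_steps d i (replicate j d @ w) = replicate j (d, i) @ label_steps d i w"
  by (induction j) auto

lemma label_steps_Suc: "label_steps d (Suc i) w = map (map_prod id Suc) (label_steps d i w)"
  by (induction w arbitrary: d i) (auto simp: Let_def)

lemma label_steps_ge: "(a, j) \<in> set (label_steps d i w) \<Longrightarrow> i \<le> j"
  by (induction w arbitrary: d i) (auto simp: Let_def dest: Suc_leD split: if_splits)

lemma length_label_steps: "length (label_steps d i w) = length w"
  by (induction w arbitrary: d i) (auto simp: Let_def)

text \<open>If \<open>s = 0\<close>, a North step at the start of \<open>w\<close> would continue
  the first vertical run instead of opening a new one; the second assumption excludes this.\<close>

lemma label_steps_first_runs:
  assumes "0 < r" and "0 < s \<or> w = []"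
  shows "label_steps East 0 (East # replicate r North @ replicate s East @ w) =
    (East, 0) # replicate r (North, 1) @ replicate s (East, 1) @ label_steps East 1 w"
proof -
  obtain r' where r: "r = Suc r'" using assms by (cases r) auto
  show ?thesis
  proof (cases s)
    case 0
    then show ?thesis using r assms label_steps_replicate[of North 1 r' "[]"] by simp
  next
    case (Suc s')
    then show ?thesis using r by (simp add: label_steps_replicate)
  qed
qed

text \<open>Since a nonempty \<open>w\<close> opens a new vertical run, its labels are at least 2,
  so the label 1 occurs only in the two displayed runs. Compared with
  \<open>label_steps East 0 w\<close> each of its labels is one higher, which adds
  \<open>length w\<close> to the sum.\<close>

lemma labels_first_runs:
  assumes B: "bounce_path P = East # replicate r North @ replicate s East @ w"
    and "0 < r" and "0 < s \<or> w = []" and w: "w = [] \<or> hd w = North"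
  shows "count_list (labelled_bounce_path P) (North, 1) = r"
    and "count_list (labelled_bounce_path P) (East, 1) = s"
    and "bounce P = r + s + length w + sum_list (map snd (label_steps East 0 w))"
proof -
  have eq: "labelled_bounce_path P =
    (East, 0) # replicate r (North, 1) @ replicate s (East, 1) @ label_steps East 1 w"
    unfolding labelled_bounce_path_def B by (rule label_steps_first_runs) (use assms in auto)
  have "(a, 1) \<notin> set (label_steps East 1 w)" for a
    using w label_steps_ge[of a 1 North 2 "tl w"] by (cases w) (auto simp: numeral_2_eq_2)
  then have "count_list (label_steps East 1 w) (a, 1) = 0" for a
    by (simp add: count_list_0_iff)
  then show "count_list (labelled_bounce_path P) (North, 1) = r"
    "count_list (labelled_bounce_path P) (East, 1) = s"
    by (simp_all add: eq count_list_replicate)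
  have "sum_list (map (snd \<circ> map_prod id Suc) l) = length l + sum_list (map snd l)"
    for l :: "(step \<times> nat) list"
    by (induction l) auto
  then show "bounce P = r + s + length w + sum_list (map snd (label_steps East 0 w))"
    using label_steps_Suc[of East 0 w]
    by (simp add: bounce_def eq sum_list_replicate length_label_steps)
qed

section \<open>Splitting off the first runs\<close>

text \<open>The two domination conditions correspond under the time shift by \<open>r + s\<close>,
  after which both long paths are \<open>r\<close> North steps ahead of the reduced ones. The times
  where this comparison is not exact, up to \<open>r + s\<close> and the first \<open>h\<close>
  steps after that, satisfy the condition for any \<open>W\<close> and \<open>X\<close>.\<close>

lemma Polyo_glue:
  assumes r: "1 \<le> r" "r < n" and s: "1 \<le> s" "s < m" and h: "1 \<le> h"
    and W: "W \<in> lattice_paths s (r - 1)" and X: "X \<in> lattice_paths (s - 1) h"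
  shows "(replicate r North @ East # X @ East # Z, East # W @ North # L1) \<in> Polyo m n \<longleftrightarrow>
    (replicate h North @ East # Z, East # L1) \<in> Polyo (m - s) (n - r)"
    (is "(?U, ?L) \<in> _ \<longleftrightarrow> (?U', ?L') \<in> _")
proof -
  note WX = lattice_pathsD[OF W] lattice_pathsD[OF X]
  have paths: "?U \<in> lattice_paths m n \<longleftrightarrow> ?U' \<in> lattice_paths (m - s) (n - r)"
    "?L \<in> lattice_paths m n \<longleftrightarrow> ?L' \<in> lattice_paths (m - s) (n - r)"
    using r s WX by (auto simp: lattice_paths_def count_list_replicate)
  \<comment> \<open>\<open>0 < i\<close> matters: the North step after \<open>W\<close> is step
    number \<open>r + s + 1\<close>.\<close>
  have L: "norths (take (r + s + i) ?L) = r + norths (take i ?L')" if "0 < i" for i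
  proof -
    obtain i' where "i = Suc i'" using \<open>0 < i\<close> gr0_implies_Suc by blast
    moreover have "?L = (East # W @ [North]) @ L1" by simp
    moreover have "length (East # W @ [North]) = Suc (r + s)" using WX r by simp
    ultimately show ?thesis using WX r by (simp only: take_append) simp
  qed
  let ?u = "replicate r North @ East # X"
  have U_eq: "?U = ?u @ East # Z" by simp
  have len_u: "length ?u = r + s + h" using WX s by simp
  have U: "norths (take (r + s + i) ?U) = r + norths (take i ?U')" if "h \<le> i" for i
  proof -
    have "take (r + s + i) ?U = ?u @ take (i - h) (East # Z)"
      unfolding U_eq using len_u that by (simp only: take_append) simp
    moreover have "take i ?U' = replicate h North @ take (i - h) (East # Z)"
      using that by simp
    ultimately show ?thesis using WX by (simp add: count_list_replicate)
  qed
  \<comment> \<open>Up to this time \<open>?U\<close> has not made the East step before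
    \<open>Z\<close>, so it has at most \<open>s\<close> East steps.\<close>
  have U_le: "r + i \<le> norths (take (r + s + i) ?U)" if "i \<le> h" for i
  proof -
    have "take (r + s + i) ?U = take (r + s + i) ?u"
      unfolding U_eq using len_u that by (simp only: take_append) simp
    moreover have "easts ?u = s" using WX s by (simp add: count_list_replicate)
    then have "easts (take (r + s + i) ?u) \<le> s" by (metis count_list_take_le)
    moreover have "easts (take (r + s + i) ?u) + norths (take (r + s + i) ?u) = r + s + i"
      using len_u that by (intro easts_plus_norths_take) simp
    ultimately show ?thesis by (simp only:)
  qed
  have U'_le: "norths (take i ?U') = i" if "i \<le> h" for i
    using that by (simp add: count_list_replicate)
  have L'_le: "norths (take i ?L') < i" if "0 < i" for i
  proof -
    obtain i' where i': "i = Suc i'" using \<open>0 < i\<close> gr0_implies_Suc by blast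
    have "length (take i' L1) \<le> i'" by simp
    then show ?thesis using i' easts_plus_norths[of "take i' L1"] by simp
  qed
  \<comment> \<open>During the first \<open>r\<close> steps \<open>?U\<close> only goes North while
    \<open>?L\<close> has begun East. After that, up to time \<open>r + s\<close>, \<open>?L\<close>
    is still inside \<open>East # W\<close>, which has \<open>r - 1\<close> North steps.\<close>
  have start: "norths (take i ?L) < norths (take i ?U)" if i: "0 < i" "i \<le> r + s" for i
  proof (cases "i \<le> r")
    case True
    obtain i' where i': "i = Suc i'" using \<open>0 < i\<close> gr0_implies_Suc by blast
    have "norths (take i ?U) = i" using True by (simp add: count_list_replicate)
    moreover have "length (take i' (W @ North # L1)) \<le> i'" by simp
    then have "norths (take i ?L) < i"
      using i' easts_plus_norths[of "take i' (W @ North # L1)"] by (simp del: take_append)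
    ultimately show ?thesis by simp
  next
    case False
    have "take i ?L = take i (East # W)" using i WX r by (cases i) auto
    then have "norths (take i ?L) \<le> r - 1"
      using count_list_take_le[of i "East # W" North] WX by simp
    moreover have "r \<le> norths (take i ?U)"
      using False by (simp add: count_list_replicate)
    ultimately show ?thesis using r by linarith
  qed
  have "(\<forall>i. 0 < i \<and> i < m + n \<longrightarrow> norths (take i ?L) < norths (take i ?U)) \<longleftrightarrow>
    (\<forall>i. 0 < i \<and> i < (m - s) + (n - r) \<longrightarrow> norths (take i ?L') < norths (take i ?U'))"
    (is "?D \<longleftrightarrow> ?D'")
  proof (intro iffI allI impI)
    fix i
    assume D: ?D and i: "0 < i \<and> i < (m - s) + (n - r)"
    show "norths (take i ?L') < norths (take i ?U')"
    proof (cases "i \<le> h")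
      case True
      then show ?thesis using U'_le[OF True] L'_le[of i] i by linarith
    next
      case False
      have "norths (take (r + s + i) ?L) < norths (take (r + s + i) ?U)"
        by (rule D[rule_format]) (use i r s in auto)
      then show ?thesis using L[of i] U[of i] False i by linarith
    qed
  next
    fix i
    assume D': ?D' and i: "0 < i \<and> i < m + n"
    show "norths (take i ?L) < norths (take i ?U)"
    proof (cases "i \<le> r + s")
      case False
      then obtain j where j: "i = r + s + j" "0 < j"
        by (metis less_imp_add_positive not_le)
      show ?thesis
      proof (cases "j \<le> h")
        case True
        then show ?thesis
          unfolding j(1) using U_le[OF True] L'_le[of j] L[of j] j(2) by linarith
      next
        case False
        have "norths (take j ?L') < norths (take j ?U')"
          by (rule D'[rule_format]) (use i j r s in auto)
        then show ?thesis unfolding j(1) using L[of j] U[of j] False j(2) by linarith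
      qed
    qed (use start i in simp)
  qed
  then show ?thesis using paths r s by (simp only: Polyo_iff)
qed

text \<open>Before its last step the lower path has at most \<open>n - 1\<close> North steps and at
  least one East step, against \<open>min i n\<close> North steps of the upper path.\<close>

lemma Polyo_full:
  assumes "1 \<le> m" "1 \<le> n" and W: "W \<in> lattice_paths (m - 1) (n - 1)"
  shows "(replicate n North @ replicate m East, East # W @ [North]) \<in> Polyo m n"
    (is "(?U, ?L) \<in> _")
proof -
  note W' = lattice_pathsD[OF W]
  have "norths (take i ?L) < norths (take i ?U)" if i: "0 < i" "i < m + n" for i
  proof -
    have "take i ?L = take i (East # W)" using i W' assms by (cases i) auto
    moreover have "norths (take i (East # W)) \<le> n - 1"
      using count_list_take_le[of i "East # W" North] W' by simp
    moreover have "norths (take i (East # W)) < i"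
      using \<open>0 < i\<close> easts_plus_norths[of "take (i - 1) W"] by (cases i) auto
    moreover have "norths (take i ?U) = min i n" by (simp add: count_list_replicate)
    ultimately show ?thesis using assms by simp
  qed
  then show ?thesis
    using assms(1,2) W' by (simp add: Polyo_iff) (auto simp: lattice_paths_def count_list_replicate)
qed

text \<open>\<open>r\<close> is the length of the initial vertical run of \<open>U\<close>. For
  \<open>r < n\<close>, \<open>L\<close> is cut at its North step number \<open>r\<close> and
  \<open>U\<close> at its East step number \<open>s + 1\<close>.\<close>

lemma Polyo_cases:
  assumes mn: "1 \<le> m" "1 \<le> n" and P: "(U, L) \<in> Polyo m n"
  obtains
    (full) W where "U = replicate n North @ replicate m East" "L = East # W @ [North]"
      "W \<in> lattice_paths (m - 1) (n - 1)"
  | (glued) r s h W X L1 Z where "1 \<le> r" "r < n" "1 \<le> s" "s < m" "1 \<le> h"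
      "W \<in> lattice_paths s (r - 1)" "X \<in> lattice_paths (s - 1) h"
      "U = replicate r North @ East # X @ East # Z" "L = East # W @ North # L1"
      "(replicate h North @ East # Z, East # L1) \<in> Polyo (m - s) (n - r)"
proof -
  have U: "easts U = m" "norths U = n" and L: "easts L = m" "norths L = n"
    and len: "length U = m + n" "length L = m + n"
    and D: "\<And>i. 0 < i \<Longrightarrow> i < m + n \<Longrightarrow> norths (take i L) < norths (take i U)"
    using P mn by (auto simp: Polyo_iff lattice_pathsD)
  obtain u V where u: "U = u @ East # V" "easts u = 0"
    using split_at_count[of 0 U East] U mn by auto
  define r where "r = norths u"
  have u_eq: "u = replicate r North" using replicate_if_no_easts[OF u(2)] by (simp only: r_def)
  have "hd L = East" "hd U = North" using P by (auto simp: Polyo_def)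
  then obtain L0 where L0: "L = East # L0" using len mn by (cases L) auto
  have r: "1 \<le> r" "r \<le> n"
  proof -
    show "1 \<le> r" using \<open>hd U = North\<close> u(1) unfolding u_eq by (cases r) auto
    show "r \<le> n" using U(2) unfolding u(1) r_def by simp
  qed
  show thesis
  proof (cases "r = n")
    case True
    then have "norths V = 0" "easts V = m - 1" using U u(2) unfolding u(1) r_def by auto
    then have "East # V = replicate m East"
      using replicate_if_no_norths[of V] mn by (cases m) auto
    then have U_eq: "U = replicate n North @ replicate m East" using u u_eq True by simp
    have "L0 \<noteq> []" using L0 L mn by auto
    then obtain W d where W: "L0 = W @ [d]" by (metis rev_exhaust)
    \<comment> \<open>One step before the end \<open>U\<close> has at most \<open>n\<close> North
      steps, so \<open>L\<close> still lacks one.\<close>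
    have "norths (take (m + n - 1) L) < norths (take (m + n - 1) U)"
      using mn by (intro D) auto
    moreover have "norths (take (m + n - 1) U) \<le> n" using U count_list_take_le by metis
    moreover have "take (m + n - 1) L = East # W" using W L0 len by (simp add: take_Cons')
    ultimately have "d = North" using W L0 L by (cases d) auto
    moreover have "W \<in> lattice_paths (m - 1) (n - 1)"
      using \<open>d = North\<close> W L0 L by (auto simp: lattice_paths_def)
    ultimately show thesis using full[OF U_eq] W L0 by blast
  next
    case False
    then have rn: "r < n" using r by simp
    have "r - 1 < norths L0" using L0 L rn by simp
    then obtain W L1 where W: "L0 = W @ North # L1" "norths W = r - 1"
      using split_at_count[of "r - 1" L0 North] by blast
    define s where "s = easts W"
    have sm: "s < m" using L0 W L s_def by auto
    have W_in: "W \<in> lattice_paths s (r - 1)" using W s_def by (simp add: lattice_paths_def)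
    have L_eq: "L = (East # W @ [North]) @ L1" using L0 W by simp
    have lenW: "length (East # W @ [North]) = Suc (r + s)"
      using lattice_pathsD[OF W_in] r by simp
    have "take (Suc (r + s)) L = East # W @ [North]"
      unfolding L_eq using lenW by (simp only: take_append) simp
    \<comment> \<open>At time \<open>r + s + 1\<close> the path \<open>L\<close> has just made its
      North step number \<open>r\<close>, so \<open>U\<close> must have made a further North step
      among the first \<open>s\<close> steps of \<open>V\<close>.\<close>
    then have "r < norths (take (Suc (r + s)) U)"
      using D[of "Suc (r + s)"] rn sm W r by simp
    moreover have "take (Suc (r + s)) U = replicate r North @ East # take s V"
      by (simp add: u u_eq)
    ultimately have V: "0 < norths (take s V)" by (simp add: count_list_replicate)
    then have s: "1 \<le> s" by (cases s) auto
    have "easts V = m - 1" using U u(2) unfolding u(1) by simp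
    then have "s - 1 < easts V" using s sm by simp
    then obtain X Z where X: "V = X @ East # Z" "easts X = s - 1"
      using split_at_count[of "s - 1" V East] by blast
    define h where "h = norths X"
    \<comment> \<open>Otherwise the first \<open>s\<close> steps of \<open>V\<close> would all be
      East.\<close>
    have h: "1 \<le> h"
    proof (rule ccontr)
      assume "\<not> 1 \<le> h"
      then have "X = replicate (s - 1) East" "norths X = 0"
        using X replicate_if_no_norths[of X] h_def by auto
      then have "take s V = X @ [East]" using X s by simp
      then show False using V \<open>norths X = 0\<close> by simp
    qed
    have X_in: "X \<in> lattice_paths (s - 1) h" using X h_def by (simp add: lattice_paths_def)
    have eqs: "U = replicate r North @ East # X @ East # Z" "L = East # W @ North # L1"
      using u u_eq X L_eq by auto
    show thesis
      using glued[OF r(1) rn s sm h W_in X_in eqs] P Polyo_glue[OF r(1) rn s sm h W_in X_in] eqs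
      by simp
  qed
qed

section \<open>Labels and area of the two kinds of polyominoes\<close>

text \<open>The first East step of \<open>U\<close> is at height \<open>n\<close>, so the bounce
  path rises to the top at once and then runs East. The area is \<open>m * n\<close> less
  \<open>area_under W\<close>; complementing \<open>W\<close> in its box of size
  \<open>(m - 1) * (n - 1)\<close> leaves \<open>m + n - 1\<close> further cells.\<close>

lemma full_statistics:
  assumes mn: "1 \<le> m" "1 \<le> n" and W: "W \<in> lattice_paths (m - 1) (n - 1)"
  defines "P \<equiv> (replicate n North @ replicate m East, East # W @ [North])"
  shows "count_list (labelled_bounce_path P) (North, 1) = n"
    and "count_list (labelled_bounce_path P) (East, 1) = m - 1"
    and "bounce P = m + n - 1"
    and "area P = m + n - 1 + area_under (rev W)"
proof -
  note W' = lattice_pathsD[OF W]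
  obtain m' where m': "m = Suc m'" using mn by (cases m) auto
  have "bounce_from P (n + m') North (1, 0) =
      replicate n North @ bounce_from P m' East (1, 0 + n)"
    using mn east_ends_split[of "replicate n North" _ "replicate m' East"]
    by (intro bounce_from_North_run) (auto simp: P_def m' count_list_replicate)
  \<comment> \<open>For \<open>m = 1\<close> no horizontal run follows. Otherwise the only North
    step of the lower path ending at height \<open>n\<close> ends at \<open>(m, n)\<close>.\<close>
  moreover have "bounce_from P m' East (1, n) = replicate m' East"
  proof (cases "m' = 0")
    case False
    have "bounce_from P (m' + 0) East (1, n) =
      replicate m' East @ bounce_from P 0 North (1 + m', n)"
      using False mn W' north_ends_split[of _ "East # W" "[]"]
      by (intro bounce_from_East_run) (auto simp: P_def m')
    then show ?thesis by simp
  qed simp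
  ultimately have B: "bounce_path P = East # replicate n North @ replicate m' East @ []"
    using mn by (simp add: bounce_path_def P_def m' add.commute)
  show "count_list (labelled_bounce_path P) (North, 1) = n"
    "count_list (labelled_bounce_path P) (East, 1) = m - 1" "bounce P = m + n - 1"
    using labels_first_runs[OF B] mn m' by auto
  have "area P + area_under (East # W @ [North]) = area_under (replicate n North @ replicate m East)"
    unfolding P_def using area_plus_area_under mn Polyo_full[OF mn W] by blast
  moreover have "area_under W + area_under (rev W) = (m - 1) * (n - 1)"
    using area_under_rev[of W] W' by simp
  moreover obtain n' where "n = Suc n'" using mn by (cases n) auto
  ultimately show "area P = m + n - 1 + area_under (rev W)"
    using m'
    by (simp add: area_under_append area_under_replicate count_list_replicate algebra_simps)
qed

text \<open>The bounce path turns at \<open>(1, r)\<close>, then at the end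
  \<open>(s + 1, r)\<close> of the North step after \<open>W\<close>, and from there it is the
  bounce path of \<open>P'\<close> translated by \<open>(s, r)\<close>. The label sum grows by
  \<open>r + s\<close> labels 1 and by one unit for each of the \<open>m + n - 1 - r - s\<close>
  remaining steps.\<close>

lemma glued_statistics:
  assumes r: "1 \<le> r" "r < n" and s: "1 \<le> s" "s < m" and h: "1 \<le> h"
    and W: "W \<in> lattice_paths s (r - 1)" and X: "X \<in> lattice_paths (s - 1) h"
    and P'_in: "(replicate h North @ East # Z, East # L1) \<in> Polyo (m - s) (n - r)"
  defines "P \<equiv> (replicate r North @ East # X @ East # Z, East # W @ North # L1)"
    and "P' \<equiv> (replicate h North @ East # Z, East # L1)"
  shows "count_list (labelled_bounce_path P) (North, 1) = r"
    and "count_list (labelled_bounce_path P) (East, 1) = s"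
    and "bounce P = m + n - 1 + bounce P'"
    and "area P = r + s + area_under (rev W) + area_under X + area P'"
proof -
  note WX = lattice_pathsD[OF W] lattice_pathsD[OF X]
  have P': "fst P' \<in> lattice_paths (m - s) (n - r)" "snd P' \<in> lattice_paths (m - s) (n - r)"
    using P'_in by (auto simp: P'_def Polyo_def)
  define k where "k = length (fst P') - 1"
  have k: "k + 1 = (m - s) + (n - r)"
    using length_lattice_path[OF P'(1)] r s by (simp add: k_def)
  have len: "length (fst P) - 1 = r + (s + k)"
    using WX s by (simp add: P_def P'_def k_def)
  have "bounce_from P (r + (s + k)) North (1, 0) =
      replicate r North @ bounce_from P (s + k) East (1, 0 + r)"
    using r east_ends_split[of "replicate r North" _ "X @ East # Z"]
    by (intro bounce_from_North_run) (auto simp: P_def count_list_replicate)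
  moreover have "bounce_from P (s + k) East (1, r) =
      replicate s East @ bounce_from P k North (1 + s, r)"
    using r s WX north_ends_split[of _ "East # W" L1]
    by (intro bounce_from_East_run) (auto simp: P_def)
  \<comment> \<open>The bounce path of \<open>P'\<close> begins with a forced East step, so
    \<open>(1, 0)\<close> is the point matching the turn at \<open>(s + 1, r)\<close>.\<close>
  moreover have "bounce_from P k North (s + 1, r + 0) = bounce_from P' k North (1, 0)"
  proof (rule bounce_from_translate)
    fix x y :: nat
    assume "0 < x" "0 < y"
    then obtain x' y' where xy: "x = Suc x'" "y = Suc y'" by (metis gr0_implies_Suc)
    \<comment> \<open>The prefix up to the end of \<open>X\<close> leads to
      \<open>(s, r + h)\<close>, and the initial run of \<open>P'\<close> to \<open>(0, h)\<close>;
      the difference is the translation vector.\<close>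
    have "(s + Suc x', r + y) \<in> east_ends ((replicate r North @ East # X) @ East # Z) \<longleftrightarrow>
      (\<exists>z. y = h + z \<and> (Suc x', z) \<in> east_ends (East # Z))"
      using east_ends_append[of "replicate r North @ East # X" x' "r + y" "East # Z"] WX s
      by (simp add: count_list_replicate add.assoc)
    moreover have "(Suc x', y) \<in> east_ends (replicate h North @ East # Z) \<longleftrightarrow>
      (\<exists>z. y = h + z \<and> (Suc x', z) \<in> east_ends (East # Z))"
      using east_ends_append[of "replicate h North" x' y "East # Z"]
      by (simp add: count_list_replicate)
    ultimately show "(s + x, r + y) \<in> east_ends (fst P) \<longleftrightarrow> (x, y) \<in> east_ends (fst P')"
      by (simp add: P_def P'_def xy(1))
    \<comment> \<open>The prefixes before \<open>L1\<close> end at \<open>(s + 1, r)\<close> and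
      \<open>(1, 0)\<close>, again differing by \<open>(s, r)\<close>.\<close>
    have "(s + x, r + Suc y') \<in> north_ends ((East # W @ [North]) @ L1) \<longleftrightarrow>
      (\<exists>z. x = 1 + z \<and> (z, Suc y') \<in> north_ends L1)"
      using north_ends_append[of "s + x" "East # W @ [North]" y' L1] WX r by simp
    moreover have "(x, Suc y') \<in> north_ends ([East] @ L1) \<longleftrightarrow>
      (\<exists>z. x = 1 + z \<and> (z, Suc y') \<in> north_ends L1)"
      using north_ends_append[of x "[East]" y' L1] by simp
    ultimately show "(s + x, r + y) \<in> north_ends (snd P) \<longleftrightarrow> (x, y) \<in> north_ends (snd P')"
      by (simp add: P_def P'_def xy(2))
  qed auto
  ultimately have B: "bounce_path P =
      East # replicate r North @ replicate s East @ bounce_from P' k North (1, 0)"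
    by (simp only: bounce_path_def len) simp
  have "bounce_from P' k North (1, 0) = [] \<or> hd (bounce_from P' k North (1, 0)) = North"
    by (cases k) auto
  note labels = labels_first_runs[OF B _ _ this]
  show "count_list (labelled_bounce_path P) (North, 1) = r"
    "count_list (labelled_bounce_path P) (East, 1) = s"
    using labels(1,2) r s by auto
  have "bounce P' = sum_list (map snd (label_steps East 0 (bounce_from P' k North (1, 0))))"
    by (simp add: bounce_def labelled_bounce_path_def bounce_path_def k_def)
  then show "bounce P = m + n - 1 + bounce P'"
    using labels(3) r s k by (simp add: length_bounce_from)
  have "area P + area_under (snd P) = area_under (fst P)"
    using area_plus_area_under[of m n "fst P" "snd P"] r s
      Polyo_glue[OF r s h W X] P'_in by (simp add: P_def)
  moreover have "area P' + area_under (snd P') = area_under (fst P')"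
    using area_plus_area_under[of "m - s" "n - r" "fst P'" "snd P'"] r s P'_in
    by (simp add: P'_def)
  \<comment> \<open>The \<open>h\<close> North steps of \<open>X\<close> precede
    \<open>East # Z\<close> just as the initial run of \<open>P'\<close> does; the initial run of
    \<open>P\<close> sees all \<open>m\<close> columns.\<close>
  moreover have "area_under (fst P) = r * m + area_under X + area_under (fst P')"
  proof -
    have "easts Z + 1 = m - s"
      using P'(1) by (simp add: P'_def lattice_paths_def count_list_replicate)
    then have "m = Suc (s + easts Z)" using s by simp
    then show ?thesis using WX s
      by (simp add: P_def P'_def area_under_append area_under_replicate count_list_replicate
          algebra_simps)
  qed
  \<comment> \<open>All \<open>r\<close> North steps up to the cut precede the
    \<open>m - s - 1\<close> East steps of \<open>L1\<close>.\<close>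
  moreover have "area_under (snd P) = area_under W + area_under (snd P') + r * (m - s - 1)"
  proof -
    have "Suc (easts L1) = m - s"
      using P'(2) by (simp add: P'_def lattice_paths_def)
    then have "m - s - 1 = easts L1" by simp
    moreover obtain r' where "r = Suc r'" using r by (cases r) auto
    ultimately show ?thesis using WX
      by (simp only:) (simp add: P_def P'_def area_under_append algebra_simps)
  qed
  moreover have "area_under W + area_under (rev W) = s * (r - 1)"
    using area_under_rev[of W] WX by simp
  \<comment> \<open>The bottom \<open>r\<close> rows consist of the part below \<open>L1\<close>,
    the box of \<open>W\<close> and \<open>r + s\<close> cells that account for
    \<open>qvar ^ (r + s)\<close>.\<close>
  moreover have "r * m = r * (m - s - 1) + (s * (r - 1) + s + r)"
  proof -
    obtain r' where "r = Suc r'" using r by (cases r) auto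
    moreover obtain d where "m = Suc (s + d)" using s less_imp_Suc_add by blast
    ultimately show ?thesis by (simp add: algebra_simps)
  qed
  ultimately show "area P = r + s + area_under (rev W) + area_under X + area P'"
    by linarith
qed

text \<open>In both kinds of polyominoes the number of unbarred labels 1 is the length of the
  initial vertical run of \<open>U\<close>. The bounds supply the ranges of \<open>h\<close> and
  \<open>k\<close> in the recursion.\<close>

lemma Polyo_first_run:
  assumes mn: "1 \<le> m" "1 \<le> n" and P: "(U, L) \<in> Polyo m n"
  defines "h \<equiv> count_list (labelled_bounce_path (U, L)) (North, 1)"
  shows "\<exists>Z L1. U = replicate h North @ East # Z \<and> L = East # L1"
    and "1 \<le> h" and "h \<le> n" and "count_list (labelled_bounce_path (U, L)) (East, 1) \<le> m - 1"
proof -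
  have "(\<exists>Z L1. U = replicate h North @ East # Z \<and> L = East # L1) \<and> 1 \<le> h \<and> h \<le> n \<and>
    count_list (labelled_bounce_path (U, L)) (East, 1) \<le> m - 1"
    using mn P
  proof (cases rule: Polyo_cases)
    case (full W)
    then have "h = n" "count_list (labelled_bounce_path (U, L)) (East, 1) = m - 1"
      using full_statistics(1,2)[OF mn full(3)] by (auto simp: h_def)
    then show ?thesis using full mn by (cases m) auto
  next
    case (glued r s h' W X L1 Z)
    then have "h = r" "count_list (labelled_bounce_path (U, L)) (East, 1) = s"
      using glued_statistics(1,2)[OF glued(1-7,10)] by (auto simp: h_def)
    then show ?thesis using glued by auto
  qed
  then show "\<exists>Z L1. U = replicate h North @ East # Z \<and> L = East # L1"
    "1 \<le> h" "h \<le> n" "count_list (labelled_bounce_path (U, L)) (East, 1) \<le> m - 1" by auto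
qed

lemma first_run_unique:
  assumes "1 \<le> m" "1 \<le> n" and P: "(replicate h North @ East # Z, L) \<in> Polyo m n"
  shows "count_list (labelled_bounce_path (replicate h North @ East # Z, L)) (North, 1) = h"
    (is "?c = h")
proof -
  obtain Z' where "replicate h North @ East # Z = replicate ?c North @ East # Z'"
    using Polyo_first_run(1)[OF assms] by blast
  then have "replicate h North = replicate ?c North"
    by (rule split_at_count_unique(1)) (simp add: count_list_replicate)
  then show ?thesis by (metis length_replicate)
qed

section \<open>The recursion\<close>

lemma qbinom_sym: "qbinom (a + b) a = qbinom (a + b) b"
  by (simp add: qbinom_def mult.commute)

text \<open>With \<open>r = n\<close> the glued form is impossible, as it has \<open>r < n\<close>.
  In the other form only \<open>W\<close> is free, and the bounce statistic is constant.\<close>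

lemma Nara_full:
  assumes mn: "1 \<le> m" "1 \<le> n"
  shows "Nara m n n s =
    (if s = m - 1 then (qvar * tvar) ^ (m + n - 1) * qbinom (m + n - 2) (m - 1) else 0)"
proof -
  let ?f = "\<lambda>W. (replicate n North @ replicate m East, East # W @ [North])"
  have full: "\<exists>W\<in>lattice_paths (m - 1) (n - 1). P = ?f W \<and> s = m - 1"
    if P_in: "P \<in> Polyo_rs m n n s" for P
  proof -
    obtain U L where P: "P = (U, L)" "(U, L) \<in> Polyo m n"
      and n: "count_list (labelled_bounce_path (U, L)) (North, 1) = n"
      and s: "count_list (labelled_bounce_path (U, L)) (East, 1) = s"
      using P_in by (cases P) (auto simp: Polyo_rs_def)
    from mn P(2) show ?thesis
    proof (cases rule: Polyo_cases)
      case (full W)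
      then show ?thesis using full_statistics(2)[OF mn full(3)] P s by auto
    next
      case (glued r s' h W X L1 Z)
      then have "n = r" using glued_statistics(1)[OF glued(1-7,10)] n by simp
      then show ?thesis using glued by simp
    qed
  qed
  show ?thesis
  proof (cases "s = m - 1")
    case True
    have img: "Polyo_rs m n n s = ?f ` lattice_paths (m - 1) (n - 1)"
    proof (rule equalityI)
      show "Polyo_rs m n n s \<subseteq> ?f ` lattice_paths (m - 1) (n - 1)" using full by blast
      show "?f ` lattice_paths (m - 1) (n - 1) \<subseteq> Polyo_rs m n n s"
        using full_statistics(1,2)[OF mn] Polyo_full[OF mn] True
        unfolding Polyo_rs_def by blast
    qed
    have "Nara m n n s =
      (\<Sum>W\<in>lattice_paths (m - 1) (n - 1). tvar ^ bounce (?f W) * qvar ^ area (?f W))"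
      unfolding Nara_def img by (subst sum.reindex) (auto simp: inj_on_def)
    also have "\<dots> = (\<Sum>W\<in>lattice_paths (m - 1) (n - 1).
      (qvar * tvar) ^ (m + n - 1) * qvar ^ area_under (rev W))"
      using full_statistics(3,4)[OF mn]
      by (intro sum.cong) (simp_all add: power_add power_mult_distrib)
    also have "\<dots> = (qvar * tvar) ^ (m + n - 1) * qbinom (m - 1 + (n - 1)) (m - 1)"
      by (simp add: sum_distrib_left[symmetric] sum_area_under_rev)
    also have "m - 1 + (n - 1) = m + n - 2" using mn by simp
    finally show ?thesis using True by simp
  next
    case False
    then have "Polyo_rs m n n s = {}" using full by blast
    then show ?thesis using False by (simp add: Nara_def)
  qed
qed

text \<open>Polyominoes are grouped by their number of barred labels 1. This is the source of the
  inner sum over \<open>k\<close>, on which the coefficients of the recursion do not depend.\<close>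

lemma sum_first_run:
  assumes mn: "1 \<le> m" "1 \<le> n"
  shows "(\<Sum>P | P \<in> Polyo m n \<and> count_list (labelled_bounce_path P) (North, 1) = h.
      tvar ^ bounce P * qvar ^ area P) = (\<Sum>k=0..m - 1. Nara m n h k)"
proof -
  let ?A = "{P \<in> Polyo m n. count_list (labelled_bounce_path P) (North, 1) = h}"
  let ?k = "\<lambda>P. count_list (labelled_bounce_path P) (East, 1)"
  have "?k ` ?A \<subseteq> {0..m - 1}" using Polyo_first_run(4)[OF mn] by auto
  then have "(\<Sum>k\<in>{0..m - 1}. \<Sum>P\<in>{P \<in> ?A. ?k P = k}. tvar ^ bounce P * qvar ^ area P) =
    (\<Sum>P\<in>?A. tvar ^ bounce P * qvar ^ area P)"
    using finite_Polyo by (intro sum.group) auto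
  moreover have "{P \<in> ?A. ?k P = k} = Polyo_rs m n h k" for k
    by (auto simp: Polyo_rs_def)
  ultimately show ?thesis by (simp add: Nara_def)
qed

text \<open>For positive \<open>s\<close>, gluing is a bijection from the free choices of
  \<open>h\<close>, \<open>W\<close>, \<open>X\<close> and a reduced polyomino with initial run
  \<open>h\<close>; the weight is a product, so the sum factors.\<close>

lemma Nara_recursion:
  assumes r: "1 \<le> r" "r < n" and s: "s < m"
  shows "Nara m n r s = tvar ^ (m + n - 1) * qvar ^ (r + s) *
    (\<Sum>h=1..n - r. \<Sum>k=0..m - s - 1.
       qbinom (s + r - 1) s * qbinom (s + h - 1) h * Nara (m - s) (n - r) h k)"
proof -
  have mn: "1 \<le> m" "1 \<le> n" "1 \<le> m - s" "1 \<le> n - r" using r s by auto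
  let ?A = "\<lambda>h. {P \<in> Polyo (m - s) (n - r). count_list (labelled_bounce_path P) (North, 1) = h}"
  let ?T = "SIGMA h:{1..n - r}. lattice_paths s (r - 1) \<times> lattice_paths (s - 1) h \<times> ?A h"
  \<comment> \<open>\<open>drop h U\<close> and \<open>tl L\<close> extract \<open>East # Z\<close>
    and \<open>L1\<close> from the reduced polyomino.\<close>
  let ?f = "\<lambda>(h, W, X, U, L). (replicate r North @ East # X @ drop h U, East # W @ North # tl L)"
  let ?g = "\<lambda>P. tvar ^ bounce P * qvar ^ area P"
  have glued: "1 \<le> s \<and> (\<exists>t\<in>?T. P = ?f t)" if P_in: "P \<in> Polyo_rs m n r s" for P
  proof -
    obtain U L where P: "P = (U, L)" "(U, L) \<in> Polyo m n"
      and c: "count_list (labelled_bounce_path (U, L)) (North, 1) = r"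
        "count_list (labelled_bounce_path (U, L)) (East, 1) = s"
      using P_in by (cases P) (auto simp: Polyo_rs_def)
    from mn(1,2) P(2) show ?thesis
    proof (cases rule: Polyo_cases)
      case (full W)
      then show ?thesis using full_statistics(1)[OF mn(1,2) full(3)] c r by simp
    next
      case (glued r' s' h W X L1 Z)
      have rs: "r' = r" "s' = s" using glued_statistics(1,2)[OF glued(1-7,10)] c glued by auto
      let ?P' = "(replicate h North @ East # Z, East # L1)"
      have P': "?P' \<in> ?A h" using first_run_unique[OF mn(3,4)] glued(10) rs by auto
      moreover have "h \<le> n - r"
        using P' Polyo_first_run(3)[OF mn(3,4), of "fst ?P'" "snd ?P'"] by auto
      ultimately have "(h, W, X, ?P') \<in> ?T" using glued rs by auto
      moreover have "P = ?f (h, W, X, ?P')" using P glued rs by simp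
      ultimately show ?thesis using glued rs by blast
    qed
  qed
  show ?thesis
  proof (cases "s = 0")
    \<comment> \<open>Gluing needs positive \<open>s\<close>, so the left side is an empty sum; on
      the right \<open>qbinom (h - 1) h\<close> vanishes as \<open>h\<close> is positive.\<close>
    case True
    then have "Polyo_rs m n r s = {}" using glued by force
    moreover have "qbinom (s + h - 1) h = 0" if "h \<in> {1..n - r}" for h
      using that True by (auto simp: qbinom_def)
    ultimately show ?thesis by (simp add: Nara_def)
  next
    case False
    then have s1: "1 \<le> s" by simp
    have T: "\<exists>Z L1. U = replicate h North @ East # Z \<and> L = East # L1 \<and> 1 \<le> h \<and>
        W \<in> lattice_paths s (r - 1) \<and> X \<in> lattice_paths (s - 1) h \<and>
        (replicate h North @ East # Z, East # L1) \<in> Polyo (m - s) (n - r)"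
      if "(h, W, X, U, L) \<in> ?T" for h W X U L
      using that Polyo_first_run(1)[OF mn(3,4), of U L] by auto
    have stat: "?f t \<in> Polyo_rs m n r s \<and>
        ?g (?f t) = (case t of (h, W, X, P) \<Rightarrow> tvar ^ (m + n - 1) * qvar ^ (r + s) *
          (qvar ^ area_under (rev W) * (qvar ^ area_under X * ?g P)))"
      if "t \<in> ?T" for t
    proof -
      obtain h W X U L where t: "t = (h, W, X, U, L)" by (metis prod_cases5)
      obtain Z L1 where *: "U = replicate h North @ East # Z" "L = East # L1" "1 \<le> h"
        "W \<in> lattice_paths s (r - 1)" "X \<in> lattice_paths (s - 1) h"
        "(replicate h North @ East # Z, East # L1) \<in> Polyo (m - s) (n - r)"
        using T \<open>t \<in> ?T\<close> t by blast
      show ?thesis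
        using glued_statistics[OF r s1 s *(3-6)] Polyo_glue[OF r s1 s *(3-5)] *(6)
        by (simp add: t *(1,2) Polyo_rs_def power_add mult_ac)
    qed
    \<comment> \<open>The cuts are recovered from the counts \<open>s - 1\<close> of East steps in
      \<open>X\<close> and \<open>r - 1\<close> of North steps in \<open>W\<close>, and
      \<open>h\<close> is the number of North steps of \<open>X\<close>.\<close>
    have inj: "inj_on ?f ?T"
    proof (rule inj_onI)
      fix t t'
      assume t_in: "t \<in> ?T" and t'_in: "t' \<in> ?T" and eq: "?f t = ?f t'"
      obtain h W X U L where t: "t = (h, W, X, U, L)" by (metis prod_cases5)
      obtain h' W' X' U' L' where t': "t' = (h', W', X', U', L')" by (metis prod_cases5)
      obtain Z L1 where *: "U = replicate h North @ East # Z" "L = East # L1"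
        "W \<in> lattice_paths s (r - 1)" "X \<in> lattice_paths (s - 1) h"
        using T t_in t by blast
      obtain Z' L1' where **: "U' = replicate h' North @ East # Z'" "L' = East # L1'"
        "W' \<in> lattice_paths s (r - 1)" "X' \<in> lattice_paths (s - 1) h'"
        using T t'_in t' by blast
      have "X @ East # Z = X' @ East # Z'" "W @ North # L1 = W' @ North # L1'"
        using eq by (simp_all add: t t' * **)
      then have "X = X'" "Z = Z'" "W = W'" "L1 = L1'"
        using split_at_count_unique[of X East Z X' Z'] split_at_count_unique[of W North L1 W' L1']
          lattice_pathsD *(3,4) **(3,4) by metis+
      moreover have "h = h'" using \<open>X = X'\<close> lattice_pathsD(2) *(4) **(4) by metis
      ultimately show "t = t'" by (simp add: t t' *(1,2) **(1,2))
    qed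
    have "Polyo_rs m n r s = ?f ` ?T" using glued stat by blast
    then have "Nara m n r s = (\<Sum>t\<in>?T. ?g (?f t))"
      unfolding Nara_def by (simp only: sum.reindex[OF inj] o_def)
    also have "\<dots> = (\<Sum>(h, W, X, P)\<in>?T. tvar ^ (m + n - 1) * qvar ^ (r + s) *
        (qvar ^ area_under (rev W) * (qvar ^ area_under X * ?g P)))"
      using stat by (intro sum.cong) auto
    also have "\<dots> = (\<Sum>h=1..n - r. \<Sum>W\<in>lattice_paths s (r - 1). \<Sum>X\<in>lattice_paths (s - 1) h.
        \<Sum>P\<in>?A h. tvar ^ (m + n - 1) * qvar ^ (r + s) *
        (qvar ^ area_under (rev W) * (qvar ^ area_under X * ?g P)))"
      using finite_Polyo by (simp add: sum.Sigma finite_lattice_paths split_def)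
    also have "\<dots> = tvar ^ (m + n - 1) * qvar ^ (r + s) *
        (\<Sum>h=1..n - r. (\<Sum>W\<in>lattice_paths s (r - 1). qvar ^ area_under (rev W)) *
          ((\<Sum>X\<in>lattice_paths (s - 1) h. qvar ^ area_under X) * (\<Sum>P\<in>?A h. ?g P)))"
      by (simp only: sum_distrib_left[symmetric] sum_distrib_right[symmetric])
    also have "\<dots> = tvar ^ (m + n - 1) * qvar ^ (r + s) *
        (\<Sum>h=1..n - r. \<Sum>k=0..m - s - 1.
           qbinom (s + r - 1) s * qbinom (s + h - 1) h * Nara (m - s) (n - r) h k)"
    proof -
      \<comment> \<open>The box of \<open>X\<close> has width \<open>s - 1\<close> and height
        \<open>h\<close>; symmetry makes \<open>h\<close> the lower index.\<close>
      have "qbinom (s - 1 + h) (s - 1) = qbinom (s + h - 1) h" for h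
        using qbinom_sym[of "s - 1" h] s1 by simp
      moreover have "s + (r - 1) = s + r - 1" using r by simp
      ultimately show ?thesis
        by (simp only: sum_area_under sum_area_under_rev sum_first_run[OF mn(3,4)])
          (simp only: sum_distrib_left mult.assoc)
    qed
    finally show ?thesis .
  qed
qed

theorem theorem5p1:
  fixes m n :: nat
  assumes "m \<ge> 1" and "n \<ge> 1"
  shows "(\<forall>r s. 1 \<le> r \<and> r \<le> n - 1 \<and> s \<le> m - 1 \<longrightarrow>
            Nara m n r s = tvar ^ (m + n - 1) * qvar ^ (r + s) *
              (\<Sum>h=1..n - r. \<Sum>k=0..m - s - 1.
                 qbinom (s + r - 1) s * qbinom (s + h - 1) h * Nara (m - s) (n - r) h k))
       \<and> (\<forall>s. s \<le> m - 1 \<longrightarrow>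
            Nara m n n s =
              (if s = m - 1 then (qvar * tvar) ^ (m + n - 1) * qbinom (m + n - 2) (m - 1) else 0))
       \<and> (\<forall>r. 1 \<le> r \<and> r < n \<longrightarrow> Nara 1 n r 0 = 0)"
proof (intro conjI allI impI)
  fix r s
  assume "1 \<le> r \<and> r \<le> n - 1 \<and> s \<le> m - 1"
  then show "Nara m n r s = tvar ^ (m + n - 1) * qvar ^ (r + s) *
    (\<Sum>h=1..n - r. \<Sum>k=0..m - s - 1.
       qbinom (s + r - 1) s * qbinom (s + h - 1) h * Nara (m - s) (n - r) h k)"
    using assms by (intro Nara_recursion) auto
next
  fix s
  show "Nara m n n s =
    (if s = m - 1 then (qvar * tvar) ^ (m + n - 1) * qbinom (m + n - 2) (m - 1) else 0)"
    using assms by (rule Nara_full)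
next
  fix r
  assume "1 \<le> r \<and> r < n"
  \<comment> \<open>In the recursion with \<open>s = 0\<close> every summand carries this
    factor.\<close>
  moreover have "qbinom (0 + h - 1) h = 0" if "h \<in> {1..n - r}" for h
    using that by (auto simp: qbinom_def)
  ultimately show "Nara 1 n r 0 = 0" by (subst Nara_recursion) simp_all
qed

end
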